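(* Let $M,N$ be computations of $\lambda_{\copyright}$. (1) For every sequence $\mathfrak s: M (\to^{\mathsf s}_{\sigma\beta_c})^* N$ there is a sequence $M (\to^{\mathsf w}_{\sigma\beta_c})^* L (\to^{\neg\mathsf w}_{\sigma\beta_c})^* N$ (for some $L$) all of whose steps are also $\to^{\mathsf s}_{\sigma\beta_c}$ steps, and which has the same number of $\beta_c$ steps as $\mathfrak s$. (2) For every sequence $\mathfrak s: M (\to^{\mathsf w}_{\sigma\beta_c})^* N$ there is a sequence $M (\to^{\mathsf w}_{\beta_c})^* L (\to^{\mathsf w}_{\sigma})^* N$ (for some $L$) with the same number of $\beta_c$ steps as $\mathfrak s$.
   Context: The computational core $\lambda_{\copyright}$ has values $V,W ::= x \mid \lambda x.M$ and computations $M,N,L ::= \,!V \mid VM$ ($x$ ranging over a countable set of variables, terms up to $\alpha$-renaming). Rules: $\beta_c$: $(\lambda x.M)(!V) \mapsto M\{V/x\}$; $\sigma$: $(\lambda y.N)((\lambda x.M)L) \mapsto (\lambda x.(\lambda y.N)M)L$ provided $x\notin \mathrm{fv}(N)$; $\sigma\beta_c=\sigma\cup\beta_c$. Contexts: $C ::= [\,] \mid\, !(\lambda x.C) \mid VC \mid (\lambda x.C)M$; surface contexts $S ::= [\,]\mid VS\mid(\lambda x.S)M$; weak contexts $W ::= [\,]\mid VW$. For a rule $\rho$: $\to^{\mathsf s}_\rho$ / $\to^{\mathsf w}_\rho$ is its closure under surface / weak contexts, and $\to^{\neg\mathsf w}_\rho$ is its closure under contexts that are not weak. A $\beta_c$ step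 is a step obtained from the rule $\beta_c$. $^*$ is reflexive–transitive closure. *)

theory Defs
  imports Main
begin

text \<open>
  Terms up to alpha-renaming are represented by de Bruijn terms: index \<open>i\<close> under \<open>k\<close> binders
  refers to the \<open>i\<close>-th enclosing binder if \<open>i < k\<close>, and to the free variable number \<open>i - k\<close>
  otherwise. \<open>Bang V\<close> stands for \<open>!V\<close>.
\<close>

datatype val = Var nat | Lam comp
     and comp = Bang val | App val comp

primrec lift_val :: "nat \<Rightarrow> val \<Rightarrow> val"
    and lift_comp :: "nat \<Rightarrow> comp \<Rightarrow> comp" where
  "lift_val k (Var i) = Var (if i < k then i else Suc i)"
| "lift_val k (Lam M) = Lam (lift_comp (Suc k) M)"
| "lift_comp k (Bang V) = Bang (lift_val k V)"
| "lift_comp k (App V M) = App (lift_val k V) (lift_comp k M)"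

text \<open>
  \<open>subst_comp M k U\<close> replaces index \<open>k\<close> by \<open>U\<close> and decrements the indices above \<open>k\<close>, since the
  binder of \<open>k\<close> disappears.
\<close>

primrec subst_val :: "val \<Rightarrow> nat \<Rightarrow> val \<Rightarrow> val"
    and subst_comp :: "comp \<Rightarrow> nat \<Rightarrow> val \<Rightarrow> comp" where
  "subst_val (Var i) k U = (if i < k then Var i else if i = k then U else Var (i - 1))"
| "subst_val (Lam M) k U = Lam (subst_comp M (Suc k) (lift_val 0 U))"
| "subst_comp (Bang V) k U = Bang (subst_val V k U)"
| "subst_comp (App V M) k U = App (subst_val V k U) (subst_comp M k U)"

datatype rule = Rbeta_c | Rsigma

text \<open>
  In \<open>Rsigma\<close>, \<open>Lam N\<close> moves under the binder of \<open>M\<close> and is therefore lifted; the lifted \<open>N\<close> does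
  not refer to that binder, which is the side condition \<open>x \<notin> fv(N)\<close>.
\<close>

inductive root :: "rule \<Rightarrow> comp \<Rightarrow> comp \<Rightarrow> bool" where
  "root Rbeta_c (App (Lam M) (Bang V)) (subst_comp M 0 V)"
| "root Rsigma (App (Lam N) (App (Lam M) L)) (App (Lam (App (lift_val 0 (Lam N)) M)) L)"

text \<open>
  The grammar \<open>C ::= [] | !(\<lambda>x.C) | V C | (\<lambda>x.C) M\<close>. Filling may capture variables: the plugged
  term is inserted without lifting.
\<close>

datatype ctx = Hole | CBangLam ctx | CArg val ctx | CLam ctx comp

primrec fill :: "ctx \<Rightarrow> comp \<Rightarrow> comp" where
  "fill Hole R = R"
| "fill (CBangLam C) R = Bang (Lam (fill C R))"
| "fill (CArg V C) R = App V (fill C R)"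
| "fill (CLam C M) R = App (Lam (fill C R)) M"

inductive surface :: "ctx \<Rightarrow> bool" where
  "surface Hole"
| "surface S \<Longrightarrow> surface (CArg V S)"
| "surface S \<Longrightarrow> surface (CLam S M)"

inductive weak :: "ctx \<Rightarrow> bool" where
  "weak Hole"
| "weak W \<Longrightarrow> weak (CArg V W)"

definition step :: "rule \<Rightarrow> ctx \<Rightarrow> comp \<Rightarrow> comp \<Rightarrow> bool" where
  "step r C M N \<longleftrightarrow> (\<exists>R R'. root r R R' \<and> M = fill C R \<and> N = fill C R')"

text \<open>
  The closure of a set of rules under the contexts satisfying \<open>P\<close>: with \<open>rs = {Rsigma, Rbeta_c}\<close>
  and \<open>P = surface\<close>, \<open>P = weak\<close> or \<open>P = (\<lambda>C. \<not> weak C)\<close> it is the surface, weak or non-weak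
  reduction for \<open>\<sigma>\<beta>\<^sub>c\<close>.
\<close>

definition red :: "rule set \<Rightarrow> (ctx \<Rightarrow> bool) \<Rightarrow> comp \<Rightarrow> comp \<Rightarrow> bool" where
  "red rs P M N \<longleftrightarrow> (\<exists>r C. r \<in> rs \<and> P C \<and> step r C M N)"

text \<open>
  A sequence of \<open>red rs P\<close> steps, recording the rule and the context of each step. Both are needed,
  as the same pair of terms may be related by different rules or through different contexts.
\<close>

inductive red_seq ::
  "rule set \<Rightarrow> (ctx \<Rightarrow> bool) \<Rightarrow> comp \<Rightarrow> (rule \<times> ctx) list \<Rightarrow> comp \<Rightarrow> bool"
  for rs :: "rule set" and P :: "ctx \<Rightarrow> bool" where
  "red_seq rs P M [] M"
| "r \<in> rs \<Longrightarrow> P C \<Longrightarrow> step r C M M' \<Longrightarrow> red_seq rs P M' s N \<Longrightarrow> red_seq rs P M ((r, C) # s) N"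

lemma red_seq_iff_rtranclp: "(\<exists>s. red_seq rs P M s N) \<longleftrightarrow> (red rs P)\<^sup>*\<^sup>* M N"
proof
  assume "\<exists>s. red_seq rs P M s N"
  then obtain s where "red_seq rs P M s N" ..
  then show "(red rs P)\<^sup>*\<^sup>* M N"
    by induction (auto simp: red_def intro: converse_rtranclp_into_rtranclp)
next
  assume "(red rs P)\<^sup>*\<^sup>* M N"
  then show "\<exists>s. red_seq rs P M s N"
    by (induction rule: converse_rtranclp_induct) (auto simp: red_def intro: red_seq.intros)
qed

definition num_beta :: "(rule \<times> ctx) list \<Rightarrow> nat" where
  "num_beta s = count_list (map fst s) Rbeta_c"

end

(*
  A weak context only sees the spine V1 (V2 (... (Vn !U))) of a computation, while a surface step
  that is not weak takes place inside the body of one of the abstractions V1, ..., Vn. Hence such a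
  step neither creates nor destroys a weak redex: a non-weak surface step followed by a weak step can
  be swapped into a weak step followed by one surface step, with the same rules. Swapping preserves
  the length of a sequence, so that sorting proceeds by induction on the length even though the
  delayed step may become weak.
  For the second part, a weak beta_c redex is always at the end of the spine. A sigma step followed
  by a beta_c step either commutes with it, or reassociates the beta_c redex itself, in which case
  the sigma step becomes superfluous.
*)
theory Submission
  imports Defs
begin

section \<open>Lifting and substitution\<close>

lemma lift_lift:
  "i \<le> k \<Longrightarrow> lift_val i (lift_val k V) = lift_val (Suc k) (lift_val i V)"
  "i \<le> k \<Longrightarrow> lift_comp i (lift_comp k M) = lift_comp (Suc k) (lift_comp i M)"
  by (induction V and M arbitrary: i k and i k) auto

lemma subst_lift [simp]:
  "subst_val (lift_val k V) k U = V"
  "subst_comp (lift_comp k M) k U = M"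
  by (induction V and M arbitrary: k U and k U) auto

lemma lift_subst_le:
  "i \<le> k \<Longrightarrow> lift_val i (subst_val V k U) = subst_val (lift_val i V) (Suc k) (lift_val i U)"
  "i \<le> k \<Longrightarrow> lift_comp i (subst_comp M k U) = subst_comp (lift_comp i M) (Suc k) (lift_val i U)"
  by (induction V and M arbitrary: i k U and i k U) (auto simp: lift_lift(1))

lemma lift_subst_ge:
  "k \<le> i \<Longrightarrow> lift_val i (subst_val V k U) = subst_val (lift_val (Suc i) V) k (lift_val i U)"
  "k \<le> i \<Longrightarrow> lift_comp i (subst_comp M k U) = subst_comp (lift_comp (Suc i) M) k (lift_val i U)"
  by (induction V and M arbitrary: i k U and i k U) (auto simp: lift_lift(1))

text \<open>This is the substitution lemma in de Bruijn form: while the binder of index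
  \<open>i\<close> is still present, the outer substitution has to act at \<open>Suc k\<close> with
  a lifted \<open>U\<close>. It makes \<open>Rbeta_c\<close> stable under substitution.\<close>

lemma subst_subst:
  "i \<le> k \<Longrightarrow> subst_val (subst_val W i V) k U =
     subst_val (subst_val W (Suc k) (lift_val i U)) i (subst_val V k U)"
  "i \<le> k \<Longrightarrow> subst_comp (subst_comp M i V) k U =
     subst_comp (subst_comp M (Suc k) (lift_val i U)) i (subst_val V k U)"
  by (induction W and M arbitrary: i k U V and i k U V)
     (auto simp: lift_lift(1) lift_subst_le(1))

text \<open>Simplification pushes \<open>lift_val 0\<close> under the abstraction, where the cutoff
  becomes \<open>Suc 0\<close>; in this form the rule matches simplified goals.\<close>

lemma root_sigma:
  "root Rsigma (App (Lam N) (App (Lam M) L))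
     (App (Lam (App (Lam (lift_comp (Suc 0) N)) M)) L)"
  using root.intros(2) by simp

lemma root_lift: "root r M N \<Longrightarrow> root r (lift_comp k M) (lift_comp k N)"
  by (induction rule: root.induct)
     (auto simp: lift_subst_ge lift_lift(2)[symmetric] intro: root.intros root_sigma)

lemma root_subst: "root r M N \<Longrightarrow> root r (subst_comp M k U) (subst_comp N k U)"
  by (induction rule: root.induct)
     (auto simp: subst_subst lift_subst_le(2)[symmetric] lift_lift(1)
       intro: root.intros root_sigma)

section \<open>Context-free characterisations of weak and surface steps\<close>

inductive weak_step :: "rule \<Rightarrow> comp \<Rightarrow> comp \<Rightarrow> bool" for r where
  root: "root r M N \<Longrightarrow> weak_step r M N"
| arg: "weak_step r M N \<Longrightarrow> weak_step r (App V M) (App V N)"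

inductive surface_step :: "rule \<Rightarrow> comp \<Rightarrow> comp \<Rightarrow> bool" for r where
  root: "root r M N \<Longrightarrow> surface_step r M N"
| arg: "surface_step r M N \<Longrightarrow> surface_step r (App V M) (App V N)"
| body: "surface_step r P Q \<Longrightarrow> surface_step r (App (Lam P) M) (App (Lam Q) M)"

text \<open>There is no root rule because \<open>Hole\<close> is weak. Once \<open>body\<close> has
  entered an abstraction, the context is non-weak whatever follows, so any surface step is allowed
  there.\<close>

inductive nonweak_step :: "rule \<Rightarrow> comp \<Rightarrow> comp \<Rightarrow> bool" for r where
  arg: "nonweak_step r M N \<Longrightarrow> nonweak_step r (App V M) (App V N)"
| body: "surface_step r P Q \<Longrightarrow> nonweak_step r (App (Lam P) M) (App (Lam Q) M)"

lemma step_Hole: "root r M N \<Longrightarrow> step r Hole M N"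
  by (auto simp: step_def)

lemma step_CArg: "step r C M N \<Longrightarrow> step r (CArg V C) (App V M) (App V N)"
  by (auto simp: step_def)

lemma step_CLam: "step r C P Q \<Longrightarrow> step r (CLam C M) (App (Lam P) M) (App (Lam Q) M)"
  by (auto simp: step_def)

lemma weak_CArg_iff [simp]: "weak (CArg V C) \<longleftrightarrow> weak C"
  by (auto intro: weak.intros elim: weak.cases)

lemma not_weak_CLam [simp]: "\<not> weak (CLam C M)"
  by (auto elim: weak.cases)

lemma weak_imp_surface: "weak C \<Longrightarrow> surface C"
  by (induction rule: weak.induct) (auto intro: surface.intros)

lemma weak_step_iff: "weak_step r M N \<longleftrightarrow> (\<exists>C. weak C \<and> step r C M N)"
proof
  assume "weak_step r M N"
  then show "\<exists>C. weak C \<and> step r C M N"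
    by induction (blast intro: weak.intros step_Hole step_CArg)+
next
  have "weak_step r (fill C R) (fill C R')" if "weak C" "root r R R'" for C R R'
    using that by induction (auto intro: weak_step.intros)
  then show "weak_step r M N" if "\<exists>C. weak C \<and> step r C M N"
    using that by (auto simp: step_def)
qed

lemma surface_step_iff: "surface_step r M N \<longleftrightarrow> (\<exists>C. surface C \<and> step r C M N)"
proof
  assume "surface_step r M N"
  then show "\<exists>C. surface C \<and> step r C M N"
    by induction (blast intro: surface.intros step_Hole step_CArg step_CLam)+
next
  have "surface_step r (fill C R) (fill C R')" if "surface C" "root r R R'" for C R R'
    using that by induction (auto intro: surface_step.intros)
  then show "surface_step r M N" if "\<exists>C. surface C \<and> step r C M N"
    using that by (auto simp: step_def)
qed

lemma nonweak_stepI: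
  assumes "surface C" "\<not> weak C" "step r C M N"
  shows "nonweak_step r M N"
proof -
  have "nonweak_step r (fill C R) (fill C R')" if "root r R R'" for R R'
    using assms(1,2)
  proof induction
    case 1
    then show ?case by (simp add: weak.intros)
  next
    case (2 S V)
    then show ?case by (auto intro: nonweak_step.intros)
  next
    case (3 S M)
    then have "surface_step r (fill S R) (fill S R')"
      using that by (auto simp: surface_step_iff step_def)
    then show ?case by (auto intro: nonweak_step.intros)
  qed
  then show ?thesis using assms(3) by (auto simp: step_def)
qed

lemma nonweak_step_imp_surface_step: "nonweak_step r M N \<Longrightarrow> surface_step r M N"
  by (induction rule: nonweak_step.induct) (auto intro: surface_step.intros)

text \<open>A weak \<open>Rsigma\<close> step moves the body of an abstraction under a further
  binder, and a weak \<open>Rbeta_c\<close> step instantiates it. Stability under lifting and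
  substitution lets a step inside that body survive both.\<close>

lemma surface_step_lift:
  "surface_step r M N \<Longrightarrow> surface_step r (lift_comp k M) (lift_comp k N)"
  by (induction arbitrary: k rule: surface_step.induct) (auto intro: surface_step.intros root_lift)

lemma surface_step_subst:
  "surface_step r M N \<Longrightarrow> surface_step r (subst_comp M k U) (subst_comp N k U)"
  by (induction arbitrary: k U rule: surface_step.induct)
     (auto intro: surface_step.intros root_subst)

section \<open>Swapping adjacent steps\<close>

inductive_cases root_AppE: "root r (App V M) N"
inductive_cases weak_step_AppE: "weak_step r (App V M) N"
text \<open>The rule is fixed here because a weak \<open>Rbeta_c\<close> step can produce a
  \<open>Bang\<close>, whereas a weak \<open>Rsigma\<close> step cannot.\<close>

inductive_cases weak_step_to_BangE: "weak_step Rsigma M (Bang V)"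
inductive_cases nonweak_step_to_BangE: "nonweak_step r M (Bang V)"
inductive_cases nonweak_step_to_AppE: "nonweak_step r M (App V N)"

text \<open>Exactly one step remains after the swap: surface steps never take place inside a
  \<open>Bang\<close>, so contracting a weak redex neither copies nor erases the place of the
  delayed step.\<close>

lemma nonweak_step_weak_step_swap:
  "nonweak_step r M M' \<Longrightarrow> weak_step r' M' N \<Longrightarrow> \<exists>K. weak_step r' M K \<and> surface_step r K N"
proof (induction arbitrary: N rule: nonweak_step.induct)
  case (arg M M' V)
  from arg.prems show ?case
  proof (rule weak_step_AppE)
    assume "root r' (App V M') N"
    then show ?case
    proof (rule root_AppE)
      fix P U assume "M' = Bang U"
      with arg.hyps show ?case by (auto elim: nonweak_step_to_BangE)
    next
      fix Q P L
      assume *: "r' = Rsigma" "V = Lam Q" "M' = App (Lam P) L"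
        "N = App (Lam (App (Lam (lift_comp (Suc 0) Q)) P)) L"
      \<comment> \<open>This step lies in \<open>L\<close> or in \<open>P\<close>. In both cases its
        source is again an abstraction applied to a computation, so the \<open>Rsigma\<close> redex
        is present before it.\<close>
      from arg.hyps have "nonweak_step r M (App (Lam P) L)" by (simp add: *)
      then show ?case
      proof (rule nonweak_step_to_AppE)
        fix L' assume "M = App (Lam P) L'" "nonweak_step r L' L"
        then show ?case
          unfolding * by (blast intro: weak_step.root root_sigma surface_step.arg
              nonweak_step_imp_surface_step)
      next
        fix P' P'' assume "M = App (Lam P') L" "Lam P = Lam P''" "surface_step r P' P''"
        then show ?case
          unfolding * by (blast intro: weak_step.root root_sigma surface_step.intros)
      qed
    qed
  next
    fix N' assume "N = App V N'" "weak_step r' M' N'"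
    with arg.IH show ?case by (blast intro: weak_step.arg surface_step.arg)
  qed
next
  case (body P Q M)
  from body.prems show ?case
  proof (rule weak_step_AppE)
    assume "root r' (App (Lam Q) M) N"
    then show ?case
    proof (rule root_AppE)
      fix Q' U assume *: "r' = Rbeta_c" "Lam Q = Lam Q'" "M = Bang U" "N = subst_comp Q' 0 U"
      \<comment> \<open>The step inside \<open>P\<close> becomes a step of
        \<open>subst_comp P 0 U\<close> itself and may now be weak; this is why the conclusion
        claims only a surface step.\<close>
      have "weak_step r' (App (Lam P) M) (subst_comp P 0 U)"
        unfolding * by (intro weak_step.root root.intros)
      with body.hyps * show ?case by (auto intro: surface_step_subst)
    next
      fix Q' A L
      assume *: "r' = Rsigma" "Lam Q = Lam Q'" "M = App (Lam A) L"
        "N = App (Lam (App (Lam (lift_comp (Suc 0) Q')) A)) L"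
      have "weak_step r' (App (Lam P) M) (App (Lam (App (lift_val 0 (Lam P)) A)) L)"
        unfolding * by (intro weak_step.root root.intros)
      moreover have "surface_step r (App (Lam (App (lift_val 0 (Lam P)) A)) L) N"
        using body.hyps * by (auto intro!: surface_step.body surface_step_lift)
      ultimately show ?case by blast
    qed
  next
    \<comment> \<open>The two steps act in disjoint subterms, the body and the argument.\<close>
    fix N' assume "N = App (Lam Q) N'" "weak_step r' M N'"
    with body.hyps show ?case by (blast intro: weak_step.arg surface_step.body)
  qed
qed

lemma weak_sigma_beta_swap:
  "weak_step Rsigma M M' \<Longrightarrow> weak_step Rbeta_c M' N \<Longrightarrow>
     \<exists>L. weak_step Rbeta_c M L \<and> (L = N \<or> weak_step Rsigma L N)"
proof (induction arbitrary: N rule: weak_step.induct)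
  case (root M M')
  then obtain Q P L where *: "M = App (Lam Q) (App (Lam P) L)"
      "M' = App (Lam (App (lift_val 0 (Lam Q)) P)) L"
    by (auto elim: root.cases)
  from root.prems[unfolded *(2)] show ?case
  proof (rule weak_step_AppE)
    assume "root Rbeta_c (App (Lam (App (lift_val 0 (Lam Q)) P)) L) N"
    \<comment> \<open>The lift of \<open>Q\<close> is cancelled by \<open>subst_lift\<close>, so
      contracting \<open>App (Lam P) (Bang U)\<close> before the reassociation yields the same term
      and the \<open>Rsigma\<close> step disappears.\<close>
    then obtain U where "L = Bang U" "N = App (Lam Q) (subst_comp P 0 U)"
      by (auto elim!: root_AppE)
    then show ?case
      unfolding * by (blast intro: weak_step.intros root.intros)
  next
    fix L' assume "N = App (Lam (App (lift_val 0 (Lam Q)) P)) L'" "weak_step Rbeta_c L L'"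
    then show ?case
      unfolding * by (blast intro: weak_step.intros root.intros)
  qed
next
  case (arg M M' V)
  from arg.prems show ?case
  proof (rule weak_step_AppE)
    assume "root Rbeta_c (App V M') N"
    then obtain U where "M' = Bang U" by (auto elim: root_AppE)
    with arg.hyps show ?case by (auto elim: weak_step_to_BangE root.cases)
  next
    fix N' assume "N = App V N'" "weak_step Rbeta_c M' N'"
    with arg.IH show ?case by (blast intro: weak_step.arg)
  qed
qed

section \<open>Sorting sequences\<close>

lemma num_beta_Nil [simp]: "num_beta [] = 0"
  and num_beta_Cons [simp]: "num_beta ((r, C) # s) = (if r = Rbeta_c then 1 else 0) + num_beta s"
  and num_beta_append [simp]: "num_beta (s @ t) = num_beta s + num_beta t"
  by (auto simp: num_beta_def)

lemma red_seq_append: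
  "red_seq rs P M s L \<Longrightarrow> red_seq rs P L t N \<Longrightarrow> red_seq rs P M (s @ t) N"
  by (induction rule: red_seq.induct) (auto intro: red_seq.intros)

lemma red_seq_mono:
  assumes "\<And>C. P C \<Longrightarrow> Q C"
  shows "red_seq rs P M s N \<Longrightarrow> red_seq rs Q M s N"
  by (induction rule: red_seq.induct) (auto intro: red_seq.intros assms)

lemma red_seq_contexts: "red_seq rs P M s N \<Longrightarrow> \<forall>(r, C) \<in> set s. P C"
  by (induction rule: red_seq.induct) auto

inductive_cases red_seq_ConsE: "red_seq rs P M (p # s) N"

text \<open>The length equation is what lets the induction hypothesis be applied twice: first to the
  tail of the sequence, then to the sequence rebuilt after a swap, which has the same length as that
  tail.\<close>

lemma surface_factorization:
  assumes "red_seq rs surface M s N"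
  shows "\<exists>L s1 s2. red_seq rs weak M s1 L \<and> red_seq rs (\<lambda>C. surface C \<and> \<not> weak C) L s2 N
           \<and> length (s1 @ s2) = length s \<and> num_beta (s1 @ s2) = num_beta s"
  using assms
proof (induction "length s" arbitrary: M s)
  case 0
  then have "red_seq rs weak M [] N" "red_seq rs (\<lambda>C. surface C \<and> \<not> weak C) N [] N" "s = []"
    by (auto elim: red_seq.cases intro: red_seq.intros)
  then show ?case by fastforce
next
  case (Suc n)
  from \<open>Suc n = length s\<close> obtain p t where s: "s = p # t" by (cases s) auto
  from Suc.prems[unfolded s] obtain r C M' where p: "p = (r, C)" and r: "r \<in> rs"
      and C: "surface C" and MM': "step r C M M'" and t: "red_seq rs surface M' t N"
    by (rule red_seq_ConsE) blast
  from Suc.hyps(2) s have lt: "n = length t" by simp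
  obtain L s1 s2 where s1: "red_seq rs weak M' s1 L"
      and s2: "red_seq rs (\<lambda>C. surface C \<and> \<not> weak C) L s2 N"
      and len: "length (s1 @ s2) = length t" and num: "num_beta (s1 @ s2) = num_beta t"
    using Suc.hyps(1)[OF lt t] by blast
  show ?case
  proof (cases "weak C")
    case True
    with s1 r MM' have "red_seq rs weak M ((r, C) # s1) L" by (auto intro: red_seq.intros)
    with s2 len num s p show ?thesis by fastforce
  next
    case nonweak: False
    show ?thesis
    proof (cases s1)
      case Nil
      with s1 have "M' = L" by (auto elim: red_seq.cases)
      with s2 r C nonweak MM' have "red_seq rs (\<lambda>C. surface C \<and> \<not> weak C) M ((r, C) # s2) N"
        by (auto intro: red_seq.intros)
      moreover have "red_seq rs weak M [] M" by (rule red_seq.intros)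
      ultimately show ?thesis using Nil len num s p by fastforce
    next
      case (Cons q s1')
      from s1[unfolded Cons] obtain r' W K where q: "q = (r', W)" and r': "r' \<in> rs"
          and W: "weak W" and M'K: "step r' W M' K" and s1': "red_seq rs weak K s1' L"
        by (rule red_seq_ConsE) blast
      have "nonweak_step r M M'" using C nonweak MM' by (rule nonweak_stepI)
      moreover have "weak_step r' M' K" using W M'K by (auto simp: weak_step_iff)
      ultimately obtain K' where "weak_step r' M K'" "surface_step r K' K"
        using nonweak_step_weak_step_swap by blast
      then obtain W' C' where W': "weak W'" "step r' W' M K'" and C': "surface C'" "step r C' K' K"
        by (auto simp: weak_step_iff surface_step_iff)
      \<comment> \<open>The delayed step, now from \<open>K'\<close> to \<open>K\<close>, may have
        become weak. It is therefore put in front of the rest as an ordinary surface step and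
        everything after \<open>K'\<close> is sorted again.\<close>
      have "red_seq rs surface K (s1' @ s2) N"
        using red_seq_mono[OF weak_imp_surface s1'] red_seq_mono[OF conjunct1 s2]
        by (rule red_seq_append)
      then have "red_seq rs surface K' ((r, C') # s1' @ s2) N"
        using r C' by (auto intro: red_seq.intros)
      moreover have "n = length ((r, C') # s1' @ s2)" using lt len Cons by simp
      ultimately obtain L' t1 t2 where t1: "red_seq rs weak K' t1 L'"
          and t2: "red_seq rs (\<lambda>C. surface C \<and> \<not> weak C) L' t2 N"
          and len': "length (t1 @ t2) = n"
          and num': "num_beta (t1 @ t2) = num_beta ((r, C') # s1' @ s2)"
        using Suc.hyps(1)[of "(r, C') # s1' @ s2" K'] by blast
      have "red_seq rs weak M ((r', W') # t1) L'"
        using r' W' t1 by (auto intro: red_seq.intros)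
      moreover have "length (((r', W') # t1) @ t2) = length s" using len' lt s by simp
      moreover have "num_beta (((r', W') # t1) @ t2) = num_beta s"
        using num' num Cons q s p by simp
      ultimately show ?thesis using t2 by blast
    qed
  qed
qed

text \<open>The \<open>Rsigma\<close> step is pushed rightwards through the \<open>Rbeta_c\<close>
  steps one at a time, until it reaches the end or is absorbed. Each swap keeps exactly one
  \<open>Rbeta_c\<close> step.\<close>

lemma weak_sigma_beta_seq_swap:
  assumes "red_seq {Rbeta_c} weak M' s N" and "weak_step Rsigma M M'"
  shows "\<exists>L s1 s2. red_seq {Rbeta_c} weak M s1 L \<and> red_seq {Rsigma} weak L s2 N
           \<and> num_beta (s1 @ s2) = num_beta s"
  using assms
proof (induction arbitrary: M rule: red_seq.induct)
  case (1 N)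
  then obtain C where "weak C" "step Rsigma C M N" by (auto simp: weak_step_iff)
  then have "red_seq {Rsigma} weak M [(Rsigma, C)] N" by (auto intro: red_seq.intros)
  moreover have "red_seq {Rbeta_c} weak M [] M" by (rule red_seq.intros)
  ultimately show ?case by fastforce
next
  case (2 r C M' K s N)
  then have "weak_step Rbeta_c M' K" by (auto simp: weak_step_iff)
  with 2(6) obtain L where L: "weak_step Rbeta_c M L" "L = K \<or> weak_step Rsigma L K"
    using weak_sigma_beta_swap by blast
  have "\<exists>L' s1 s2. red_seq {Rbeta_c} weak L s1 L' \<and> red_seq {Rsigma} weak L' s2 N
          \<and> num_beta (s1 @ s2) = num_beta s"
  \<comment> \<open>If \<open>L = K\<close>, the \<open>Rsigma\<close> step has been absorbed and
    \<open>s\<close> is kept unchanged; otherwise it goes on through \<open>s\<close>.\<close>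
  proof (cases "L = K")
    case True
    moreover have "red_seq {Rsigma} weak N [] N" by (rule red_seq.intros)
    ultimately show ?thesis using 2(4) by fastforce
  next
    case False
    with L(2) 2(5) show ?thesis by blast
  qed
  then obtain L' s1 s2 where "red_seq {Rbeta_c} weak L s1 L'" and s2: "red_seq {Rsigma} weak L' s2 N"
      and num: "num_beta (s1 @ s2) = num_beta s"
    by blast
  moreover obtain C' where "weak C'" "step Rbeta_c C' M L" using L(1) by (auto simp: weak_step_iff)
  ultimately have "red_seq {Rbeta_c} weak M ((Rbeta_c, C') # s1) L'" by (auto intro: red_seq.intros)
  moreover have "num_beta (((Rbeta_c, C') # s1) @ s2) = num_beta ((r, C) # s)"
    using num 2(1) by simp
  ultimately show ?case using s2 by blast
qed

text \<open>This is an insertion sort: the tail is sorted first, then a leading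
  \<open>Rbeta_c\<close> step stays in front and a leading \<open>Rsigma\<close> step is moved past
  the \<open>Rbeta_c\<close> block.\<close>

lemma weak_sigma_postponement:
  assumes "red_seq {Rsigma, Rbeta_c} weak M s N"
  shows "\<exists>L s1 s2. red_seq {Rbeta_c} weak M s1 L \<and> red_seq {Rsigma} weak L s2 N
           \<and> num_beta (s1 @ s2) = num_beta s"
  using assms
proof (induction rule: red_seq.induct)
  case (1 M)
  have "red_seq {Rbeta_c} weak M [] M" "red_seq {Rsigma} weak M [] M" by (rule red_seq.intros)+
  then show ?case by fastforce
next
  case (2 r C M M' s N)
  then obtain L s1 s2 where s1: "red_seq {Rbeta_c} weak M' s1 L" and s2: "red_seq {Rsigma} weak L s2 N"
      and num: "num_beta (s1 @ s2) = num_beta s"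
    by blast
  show ?case
  proof (cases r)
    case Rbeta_c
    with 2 s1 have "red_seq {Rbeta_c} weak M ((r, C) # s1) L" by (auto intro: red_seq.intros)
    moreover have "num_beta (((r, C) # s1) @ s2) = num_beta ((r, C) # s)" using num by simp
    ultimately show ?thesis using s2 by blast
  next
    case Rsigma
    with 2 have "weak_step Rsigma M M'" by (auto simp: weak_step_iff)
    with s1 obtain L' t1 t2 where "red_seq {Rbeta_c} weak M t1 L'"
        and "red_seq {Rsigma} weak L' t2 L" and num': "num_beta (t1 @ t2) = num_beta s1"
      using weak_sigma_beta_seq_swap by blast
    moreover from this s2 have "red_seq {Rsigma} weak L' (t2 @ s2) N"
      by (blast intro: red_seq_append)
    moreover have "num_beta (t1 @ t2 @ s2) = num_beta ((r, C) # s)" using num num' Rsigma by simp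
    ultimately show ?thesis by blast
  qed
qed

theorem mainTheorem5:
  fixes M N :: comp
  shows "(\<forall>s. red_seq {Rsigma, Rbeta_c} surface M s N \<longrightarrow>
            (\<exists>L s1 s2. red_seq {Rsigma, Rbeta_c} weak M s1 L
               \<and> red_seq {Rsigma, Rbeta_c} (\<lambda>C. \<not> weak C) L s2 N
               \<and> (\<forall>(r, C) \<in> set (s1 @ s2). surface C)
               \<and> num_beta (s1 @ s2) = num_beta s))
       \<and> (\<forall>s. red_seq {Rsigma, Rbeta_c} weak M s N \<longrightarrow>
            (\<exists>L s1 s2. red_seq {Rbeta_c} weak M s1 L
               \<and> red_seq {Rsigma} weak L s2 N
               \<and> num_beta (s1 @ s2) = num_beta s))"
proof (intro conjI allI impI)
  fix s assume "red_seq {Rsigma, Rbeta_c} surface M s N"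
  then obtain L s1 s2 where s1: "red_seq {Rsigma, Rbeta_c} weak M s1 L"
      and s2: "red_seq {Rsigma, Rbeta_c} (\<lambda>C. surface C \<and> \<not> weak C) L s2 N"
      and num: "num_beta (s1 @ s2) = num_beta s"
    using surface_factorization by blast
  have "red_seq {Rsigma, Rbeta_c} (\<lambda>C. \<not> weak C) L s2 N"
    using s2 by (rule red_seq_mono[rotated]) simp
  moreover have "\<forall>(r, C) \<in> set (s1 @ s2). surface C"
    using red_seq_contexts[OF s1] red_seq_contexts[OF s2] by (auto intro: weak_imp_surface)
  ultimately show "\<exists>L s1 s2. red_seq {Rsigma, Rbeta_c} weak M s1 L
      \<and> red_seq {Rsigma, Rbeta_c} (\<lambda>C. \<not> weak C) L s2 N
      \<and> (\<forall>(r, C) \<in> set (s1 @ s2). surface C) \<and> num_beta (s1 @ s2) = num_beta s"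
    using s1 num by blast
next
  fix s assume "red_seq {Rsigma, Rbeta_c} weak M s N"
  then show "\<exists>L s1 s2. red_seq {Rbeta_c} weak M s1 L \<and> red_seq {Rsigma} weak L s2 N
      \<and> num_beta (s1 @ s2) = num_beta s"
    by (rule weak_sigma_postponement)
qed

end
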